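(* Let $(X,\rho)$ be a compact metric space, let $d\ge 1$, let $T:\mathbb{Z}^d\times X\to X$ be a continuous $\mathbb{Z}^d$-action on $X$, and let $k\in\{1,\dots,2^d\}$. If $(X,T)$ is $k$-type weakly mixing, then the induced action $(Sub_X,\hat{T})$ on the hyperspace $Sub_X$ is $k$-type transitive.
   Context: A $\mathbb{Z}^d$-action on $X$ is a continuous map $T:\mathbb{Z}^d\times X\to X$, written $T^n(x)=T(n,x)$, with $T^0(x)=x$ and $T^{n+m}(x)=T^n(T^m(x))$ for all $x\in X$, $n,m\in\mathbb{Z}^d$. For $k\in\{1,\dots,2^d\}$ let $k^b=(k^b_1,\dots,k^b_d)\in\{0,1\}^d$ be defined by $k-1=\sum_{i=1}^d k^b_i 2^{i-1}$. For $x,y\in\mathbb{Z}^d$, write $x\ge^k y$ if $(-1)^{k^b_i}x_i\ge(-1)^{k^b_i}y_i$ for all $i=1,\dots,d$. The hyperspace $Sub_X$ is the set of all non-empty closed (equivalently, non-empty compact) subsets of $X$, endowed with the Hausdorff metric $H(A,B)=\max\{\sup_{a\in A}\rho(a,B),\sup_{b\in B}\rho(b,A)\}$, where $\rho(x,S)=\inf_{s\in S}\rho(x,s)$; it is a compact metric space. The induced $\mathbb{Z}^d$-action $\hat{T}$ on $Sub_X$ is $\hat{T}^m(A)=T^m(A)=\{T^m(x):x\in A\}$. A $\mathbb{Z}^d$-action $T$ on a space $X$ is $k$-type transitive if for any non-empty open $U,V\subseteq X$ there is $m\in\mathbb{Z}^d$ with $m\ge^k 0$ and $T^m(U)\cap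 V\ne\emptyset$ (the same definition applies to $(Sub_X,\hat{T})$). It is $k$-type weakly mixing if the product action $T\times T$ on $X\times X$ is $k$-type transitive; equivalently, for any four non-empty open sets $U_1,U_2,V_1,V_2\subseteq X$ there is $m\ge^k 0$ such that $T^m(U_1)\cap V_1\neq\emptyset$ and $T^m(U_2)\cap V_2\ne\emptyset$. *)

theory Defs
  imports "HOL-Analysis.Analysis" "HOL-Algebra.Elementary_Groups" "HOL-Algebra.Product_Groups"
begin

section \<open>The group of integer vectors and its orthant orders\<close>

text \<open>Vectors are extensional functions on \<open>{1..d}\<close>, so that the coordinates carry the numbering
  on which the orders below depend. The group is written multiplicatively by the library, so
  \<open>n \<otimes>\<^bsub>int_lattice d\<^esub> m\<close> is the coordinatewise sum and \<open>\<one>\<^bsub>int_lattice d\<^esub>\<close> the zero vector.\<close>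

definition int_lattice :: "nat \<Rightarrow> (nat \<Rightarrow> int) monoid"
  where "int_lattice d = product_group {1..d} (\<lambda>_. integer_group)"

text \<open>\<open>sign_digit k i\<close> is the \<open>i\<close>-th binary digit (counting from 1) of \<open>k - 1\<close>;
  see \<open>sign_digit_expansion\<close>.\<close>

definition sign_digit :: "nat \<Rightarrow> nat \<Rightarrow> nat"
  where "sign_digit k i = (k - 1) div 2 ^ (i - 1) mod 2"

definition type_ge :: "nat \<Rightarrow> nat \<Rightarrow> (nat \<Rightarrow> int) \<Rightarrow> (nat \<Rightarrow> int) \<Rightarrow> bool"
  where "type_ge d k x y \<longleftrightarrow>
    (\<forall>i\<in>{1..d}. (-1) ^ sign_digit k i * x i \<ge> (-1) ^ sign_digit k i * y i)"

lemma sign_digit_01: "sign_digit k i \<in> {0, 1}"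
  by (auto simp: sign_digit_def)

lemma sign_digit_expansion:
  assumes "k \<in> {1..2 ^ d}"
  shows "k - 1 = (\<Sum>i=1..d. sign_digit k i * 2 ^ (i - 1))"
proof -
  have *: "(\<Sum>i=1..d. sign_digit k i * 2 ^ (i - 1)) = (k - 1) mod 2 ^ d"
  proof (induction d)
    case (Suc d)
    then show ?case
      by (simp add: sign_digit_def power_Suc2 mod_mult2_eq del: power_Suc)
  qed simp
  have "k - 1 < 2 ^ d"
    using assms by auto
  then show ?thesis
    using * by simp
qed

lemma sign_digit_unique:
  assumes "\<And>i. i \<in> {1..d} \<Longrightarrow> b i \<in> {0, 1}"
    and "k - 1 = (\<Sum>i=1..d. b i * 2 ^ (i - 1))" and "i \<in> {1..d}"
  shows "b i = sign_digit k i"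
proof -
  have less: "(\<Sum>i=1..n. b i * 2 ^ (i - 1)) < 2 ^ n" if "n \<le> d" for n
    using that
  proof (induction n)
    case (Suc n)
    have "b (Suc n) \<in> {0, 1}"
      using assms(1)[of "Suc n"] Suc.prems by auto
    moreover have "(\<Sum>i=1..n. b i * 2 ^ (i - 1)) < 2 ^ n"
      using Suc by simp
    ultimately show ?case
      by auto
  qed simp
  have "\<forall>i\<in>{1..n}. (\<Sum>i=1..n. b i * 2 ^ (i - 1)) div 2 ^ (i - 1) mod 2 = b i" if "n \<le> d" for n
    using that
  proof (induction n)
    case (Suc n)
    let ?s = "\<Sum>i=1..n. b i * 2 ^ (i - 1)"
    have b: "b (Suc n) \<in> {0, 1}"
      using assms(1)[of "Suc n"] Suc.prems by auto
    show ?case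
    proof
      fix i assume i: "i \<in> {1..Suc n}"
      show "(\<Sum>i=1..Suc n. b i * 2 ^ (i - 1)) div 2 ^ (i - 1) mod 2 = b i"
      proof (cases "i = Suc n")
        case True
        then show ?thesis
          using b less[of n] Suc.prems by auto
      next
        case False
        with i have i': "i \<in> {1..n}" by auto
        then have "(2::nat) ^ n = 2 ^ (i - 1) * (2 * 2 ^ (n - i))"
          by (simp flip: power_Suc power_add add: Suc_diff_le)
        then have "(?s + b (Suc n) * 2 ^ n) div 2 ^ (i - 1)
            = (2 * (b (Suc n) * 2 ^ (n - i)) * 2 ^ (i - 1) + ?s) div 2 ^ (i - 1)"
          by (simp add: ac_simps)
        also have "\<dots> = 2 * (b (Suc n) * 2 ^ (n - i)) + ?s div 2 ^ (i - 1)"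
          by (rule div_mult_self3) simp
        finally have "(?s + b (Suc n) * 2 ^ n) div 2 ^ (i - 1) mod 2 = ?s div 2 ^ (i - 1) mod 2"
          by simp
        then show ?thesis
          using Suc i' by simp
      qed
    qed
  qed simp
  from this[of d] show ?thesis
    using assms by (simp add: sign_digit_def)
qed


section \<open>Actions, transitivity and weak mixing\<close>

definition int_action :: "nat \<Rightarrow> 'a topology \<Rightarrow> ((nat \<Rightarrow> int) \<Rightarrow> 'a \<Rightarrow> 'a) \<Rightarrow> bool"
  where "int_action d Y T \<longleftrightarrow>
    continuous_map (prod_topology (discrete_topology (carrier (int_lattice d))) Y) Y
      (\<lambda>(n, x). T n x) \<and>
    (\<forall>x\<in>topspace Y. T \<one>\<^bsub>int_lattice d\<^esub> x = x) \<and>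
    (\<forall>n\<in>carrier (int_lattice d). \<forall>m\<in>carrier (int_lattice d). \<forall>x\<in>topspace Y.
      T (n \<otimes>\<^bsub>int_lattice d\<^esub> m) x = T n (T m x))"

definition type_transitive ::
    "nat \<Rightarrow> nat \<Rightarrow> 'a topology \<Rightarrow> ((nat \<Rightarrow> int) \<Rightarrow> 'a \<Rightarrow> 'a) \<Rightarrow> bool"
  where "type_transitive d k Y T \<longleftrightarrow>
    (\<forall>U V. openin Y U \<and> U \<noteq> {} \<and> openin Y V \<and> V \<noteq> {} \<longrightarrow>
      (\<exists>m\<in>carrier (int_lattice d). type_ge d k m \<one>\<^bsub>int_lattice d\<^esub> \<and> T m ` U \<inter> V \<noteq> {}))"

definition type_weakly_mixing ::
    "nat \<Rightarrow> nat \<Rightarrow> 'a topology \<Rightarrow> ((nat \<Rightarrow> int) \<Rightarrow> 'a \<Rightarrow> 'a) \<Rightarrow> bool"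
  where "type_weakly_mixing d k Y T \<longleftrightarrow>
    type_transitive d k (prod_topology Y Y) (\<lambda>m. map_prod (T m) (T m))"

definition induced_action :: "((nat \<Rightarrow> int) \<Rightarrow> 'a \<Rightarrow> 'a) \<Rightarrow> (nat \<Rightarrow> int) \<Rightarrow> 'a set \<Rightarrow> 'a set"
  where "induced_action T m A = T m ` A"


section \<open>The hyperspace\<close>

context Metric_space
begin

definition hyperspace :: "'a set set"
  where "hyperspace = {A. closedin mtopology A \<and> A \<noteq> {}}"

definition point_dist :: "'a \<Rightarrow> 'a set \<Rightarrow> real"
  where "point_dist x S = (INF s\<in>S. d x s)"

text \<open>The value 0 off the hyperspace is a dummy: \<open>Metric_space\<close> demands a nonnegative function
  on the whole type.\<close>

definition Hausdorff_metric :: "'a set \<Rightarrow> 'a set \<Rightarrow> real"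
  where "Hausdorff_metric A B =
    (if A \<in> hyperspace \<and> B \<in> hyperspace
     then max (SUP a\<in>A. point_dist a B) (SUP b\<in>B. point_dist b A) else 0)"

abbreviation hypertopology :: "'a set topology"
  where "hypertopology \<equiv> Metric_space.mtopology hyperspace Hausdorff_metric"

lemma point_dist_le: "s \<in> S \<Longrightarrow> point_dist x S \<le> d x s"
  unfolding point_dist_def by (rule cINF_lower) (auto intro: bdd_belowI2[where m = 0])

lemma point_dist_greatest: "S \<noteq> {} \<Longrightarrow> (\<And>s. s \<in> S \<Longrightarrow> c \<le> d x s) \<Longrightarrow> c \<le> point_dist x S"
  unfolding point_dist_def by (rule cINF_greatest)

lemma point_dist_eq_0_imp:
  assumes "closedin mtopology S" "S \<noteq> {}" "x \<in> M" "point_dist x S = 0"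
  shows "x \<in> S"
proof (rule ccontr)
  assume "x \<notin> S"
  then obtain r where "r > 0" "disjnt S (mball x r)"
    using assms(1,3) unfolding closedin_metric by blast
  moreover have "S \<subseteq> M"
    using assms(1) closedin_metric by blast
  ultimately have "r \<le> d x s" if "s \<in> S" for s
    using that assms(3) by (force simp: disjnt_iff)
  then have "r \<le> point_dist x S"
    using assms(2) by (intro point_dist_greatest)
  then show False
    using assms(4) \<open>r > 0\<close> by simp
qed

lemma Metric_space_hyperspace:
  assumes "compact_space mtopology"
  shows "Metric_space hyperspace Hausdorff_metric"
proof -
  obtain K where K: "d x y \<le> K" if "x \<in> M" "y \<in> M" for x y
  proof -
    have "mbounded M"
      using assms compactin_imp_mbounded by (simp add: compact_space_def)
    then show ?thesis
      using that unfolding mbounded_alt by blast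
  qed
  have sub: "A \<subseteq> M" "A \<noteq> {}" "closedin mtopology A" if "A \<in> hyperspace" for A
    using that closedin_metric by (auto simp: hyperspace_def)
  define e where "e A B = (SUP a\<in>A. point_dist a B)" for A B
  have e_upper: "point_dist a B \<le> e A B" if "a \<in> A" "A \<in> hyperspace" "B \<in> hyperspace" for a A B
    unfolding e_def
  proof (rule cSUP_upper[OF that(1)], rule bdd_aboveI2)
    fix x assume "x \<in> A"
    then show "point_dist x B \<le> K"
      by (metis K point_dist_le order_trans ex_in_conv sub(1,2) subsetD that(2,3))
  qed
  have e_least: "e A B \<le> c"
    if "A \<in> hyperspace" "\<And>a. a \<in> A \<Longrightarrow> point_dist a B \<le> c" for A B c
    unfolding e_def using sub(2)[OF that(1)] that(2) by (rule cSUP_least)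
  have pd_nonneg: "0 \<le> point_dist a B" if "B \<in> hyperspace" for a B
    using sub(2)[OF that] by (intro point_dist_greatest) auto
  have e_nonneg: "0 \<le> e A B" if "A \<in> hyperspace" "B \<in> hyperspace" for A B
    using e_upper[OF _ that] pd_nonneg[OF that(2)] sub(2)[OF that(1)]
    by (meson ex_in_conv order_trans)
  have e_self: "e A A = 0" if "A \<in> hyperspace" for A
  proof (rule antisym)
    show "e A A \<le> 0"
    proof (rule e_least[OF that])
      fix a assume "a \<in> A"
      moreover from this have "d a a = 0"
        using sub(1)[OF that] by auto
      ultimately show "point_dist a A \<le> 0"
        using point_dist_le[of a A a] by simp
    qed
  qed (use e_nonneg that in auto)
  have e_0: "A \<subseteq> B" if "A \<in> hyperspace" "B \<in> hyperspace" "e A B \<le> 0" for A B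
  proof
    fix a assume a: "a \<in> A"
    then have "point_dist a B = 0"
      using e_upper[OF a that(1,2)] pd_nonneg[OF that(2), of a] that(3) by linarith
    then show "a \<in> B"
      using point_dist_eq_0_imp[OF sub(3,2)[OF that(2)]] sub(1)[OF that(1)] a by auto
  qed
  have e_triangle: "e A C \<le> e A B + e B C"
    if "A \<in> hyperspace" "B \<in> hyperspace" "C \<in> hyperspace" for A B C
  proof (rule e_least[OF that(1)])
    fix a assume a: "a \<in> A"
    have "point_dist a C - e B C \<le> point_dist a B"
    proof (rule point_dist_greatest)
      fix b assume b: "b \<in> B"
      have "point_dist a C - d a b \<le> point_dist b C"
      proof (rule point_dist_greatest)
        fix c assume c: "c \<in> C"
        then have "d a c \<le> d a b + d b c"
          using a b sub(1)[OF that(1)] sub(1)[OF that(2)] sub(1)[OF that(3)]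
          by (intro triangle) auto
        then show "point_dist a C - d a b \<le> d b c"
          using point_dist_le[OF c, of a] by linarith
      qed (use sub that in auto)
      then show "point_dist a C - e B C \<le> d a b"
        using e_upper[OF b that(2,3)] by linarith
    qed (use sub that in auto)
    then show "point_dist a C \<le> e A B + e B C"
      using e_upper[OF a that(1,2)] by linarith
  qed
  have H: "Hausdorff_metric A B = max (e A B) (e B A)"
    if "A \<in> hyperspace" "B \<in> hyperspace" for A B
    using that by (simp add: Hausdorff_metric_def e_def)
  show ?thesis
  proof
    fix A B
    show "0 \<le> Hausdorff_metric A B"
      using H[of A B] e_nonneg[of A B] by (cases "A \<in> hyperspace \<and> B \<in> hyperspace")
        (auto simp: Hausdorff_metric_def)
    show "Hausdorff_metric A B = Hausdorff_metric B A"
      by (auto simp: Hausdorff_metric_def max.commute)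
  next
    fix A B assume "A \<in> hyperspace" "B \<in> hyperspace"
    then have "max (e A B) (e B A) = 0 \<longleftrightarrow> A = B"
      using e_0[of A B] e_0[of B A] e_self[of A]
      by (metis max.cobounded1 max.cobounded2 max.idem subset_antisym)
    then show "Hausdorff_metric A B = 0 \<longleftrightarrow> A = B"
      using \<open>A \<in> hyperspace\<close> \<open>B \<in> hyperspace\<close> by (simp add: H)
  next
    fix A B C assume "A \<in> hyperspace" "B \<in> hyperspace" "C \<in> hyperspace"
    then show "Hausdorff_metric A C \<le> Hausdorff_metric A B + Hausdorff_metric B C"
      using e_triangle[of A B C] e_triangle[of C B A] by (simp add: H max_def)
  qed
qed

end

end

theory Submission
  imports Defs
begin

text \<open>
  The argument combines Furstenberg's intersection lemma with the density of the finite sets in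
  the hyperspace. Write \<open>N(U, V)\<close> for the set of times \<open>m\<close> at which \<open>T m ` U\<close> meets \<open>V\<close>. Because
  the acting group is commutative, a single time \<open>n\<close> that carries part of \<open>U\<^sub>1\<close> into \<open>U\<^sub>2\<close> and part
  of \<open>V\<^sub>1\<close> into \<open>V\<^sub>2\<close>, as weak mixing provides, yields non-empty open \<open>U \<subseteq> U\<^sub>1\<close>, \<open>V \<subseteq> V\<^sub>1\<close> with
  \<open>N(U, V) \<subseteq> N(U\<^sub>1, V\<^sub>1) \<inter> N(U\<^sub>2, V\<^sub>2)\<close>. Iterating this (\<open>weakly_mixing_hitting_times_refine\<close>), any
  finite family of pairs of non-empty open sets has a common hitting time in the given orthant
  (\<open>weakly_mixing_common_hitting_time\<close>).

  Given closed sets \<open>A\<close> and \<open>B\<close>, choose finite \<open>r\<close>-nets \<open>F\<close> of \<open>A\<close> and \<open>G\<close> of \<open>B\<close>, and take a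
  common hitting time \<open>m\<close> for all pairs of balls of radius \<open>r\<close> around some \<open>a \<in> F\<close> and some
  \<open>b \<in> G\<close>. One point from each intersection forms a finite set \<open>C\<close> that is Hausdorff-close to
  \<open>A\<close> while \<open>T m ` C\<close> is close to \<open>B\<close> (\<open>Hausdorff_metric_le_net\<close>). Using every pair
  in \<open>F \<times> G\<close>, rather than a matching between \<open>F\<close> and \<open>G\<close>, spares any comparison of the sizes
  of the two nets.
\<close>

section \<open>Common hitting times of finitely many pairs of open sets\<close>

lemma int_action_continuous_map:
  assumes "int_action d Y T" "m \<in> carrier (int_lattice d)"
  shows "continuous_map Y Y (T m)"
proof -
  have "continuous_map Y (prod_topology (discrete_topology (carrier (int_lattice d))) Y) (\<lambda>x. (m, x))"
    using assms(2) by (intro continuous_map_pairedI) auto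
  then have "continuous_map Y Y ((\<lambda>(n, x). T n x) \<circ> (\<lambda>x. (m, x)))"
    using assms(1) unfolding int_action_def by (blast intro: continuous_map_compose)
  then show ?thesis
    by (simp add: o_def)
qed

lemma int_action_commute:
  assumes "int_action d Y T" "m \<in> carrier (int_lattice d)" "n \<in> carrier (int_lattice d)"
    and "x \<in> topspace Y"
  shows "T m (T n x) = T n (T m x)"
proof -
  have "m \<otimes>\<^bsub>int_lattice d\<^esub> n = n \<otimes>\<^bsub>int_lattice d\<^esub> m"
    by (auto simp: int_lattice_def integer_group_def add.commute)
  then show ?thesis
    using assms unfolding int_action_def by metis
qed

lemma type_weakly_mixingE:
  assumes "type_weakly_mixing d k Y T"
    and "openin Y U\<^sub>1" "U\<^sub>1 \<noteq> {}" "openin Y V\<^sub>1" "V\<^sub>1 \<noteq> {}"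
    and "openin Y U\<^sub>2" "U\<^sub>2 \<noteq> {}" "openin Y V\<^sub>2" "V\<^sub>2 \<noteq> {}"
  obtains m where "m \<in> carrier (int_lattice d)" "type_ge d k m \<one>\<^bsub>int_lattice d\<^esub>"
    and "T m ` U\<^sub>1 \<inter> V\<^sub>1 \<noteq> {}" "T m ` U\<^sub>2 \<inter> V\<^sub>2 \<noteq> {}"
proof -
  have "openin (prod_topology Y Y) (U\<^sub>1 \<times> U\<^sub>2) \<and> U\<^sub>1 \<times> U\<^sub>2 \<noteq> {} \<and>
      openin (prod_topology Y Y) (V\<^sub>1 \<times> V\<^sub>2) \<and> V\<^sub>1 \<times> V\<^sub>2 \<noteq> {}"
    using assms by (simp add: openin_prod_Times_iff)
  with assms(1) have "\<exists>m\<in>carrier (int_lattice d). type_ge d k m \<one>\<^bsub>int_lattice d\<^esub> \<and>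
      map_prod (T m) (T m) ` (U\<^sub>1 \<times> U\<^sub>2) \<inter> (V\<^sub>1 \<times> V\<^sub>2) \<noteq> {}"
    unfolding type_weakly_mixing_def type_transitive_def by (elim allE impE)
  then obtain m where "m \<in> carrier (int_lattice d)" "type_ge d k m \<one>\<^bsub>int_lattice d\<^esub>"
    and "map_prod (T m) (T m) ` (U\<^sub>1 \<times> U\<^sub>2) \<inter> (V\<^sub>1 \<times> V\<^sub>2) \<noteq> {}"
    by blast
  moreover from this(3) have "T m ` U\<^sub>1 \<inter> V\<^sub>1 \<noteq> {}" "T m ` U\<^sub>2 \<inter> V\<^sub>2 \<noteq> {}"
    by auto
  ultimately show thesis
    by (intro that)
qed

text \<open>The inductive step replaces the pairs \<open>(U\<^sub>1, V\<^sub>1)\<close> and \<open>(U\<^sub>2, V\<^sub>2)\<close> by one pair, cut out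
  with a time \<open>n\<close> that is common to \<open>(U\<^sub>1, U\<^sub>2)\<close> and \<open>(V\<^sub>1, V\<^sub>2)\<close>: mixing is applied
  to the two sources and the two targets, not to the given pairs.\<close>

lemma weakly_mixing_hitting_times_refine:
  assumes act: "int_action d Y T" and mix: "type_weakly_mixing d k Y T"
    and "finite P" "P \<noteq> {}"
    and "\<And>U V. (U, V) \<in> P \<Longrightarrow> openin Y U \<and> U \<noteq> {} \<and> openin Y V \<and> V \<noteq> {}"
  shows "\<exists>U V. openin Y U \<and> U \<noteq> {} \<and> openin Y V \<and> V \<noteq> {} \<and>
    (\<forall>m\<in>carrier (int_lattice d). T m ` U \<inter> V \<noteq> {} \<longrightarrow> (\<forall>(U', V')\<in>P. T m ` U' \<inter> V' \<noteq> {}))"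
  using assms(3-)
proof (induction P rule: finite_ne_induct)
  case (singleton p)
  then show ?case
    by (cases p) auto
next
  case (insert p P)
  obtain U\<^sub>2 V\<^sub>2 where p: "p = (U\<^sub>2, V\<^sub>2)"
    by (cases p)
  then have open\<^sub>2: "openin Y U\<^sub>2" "U\<^sub>2 \<noteq> {}" "openin Y V\<^sub>2" "V\<^sub>2 \<noteq> {}"
    using insert.prems by auto
  obtain U\<^sub>1 V\<^sub>1 where open\<^sub>1: "openin Y U\<^sub>1" "U\<^sub>1 \<noteq> {}" "openin Y V\<^sub>1" "V\<^sub>1 \<noteq> {}"
    and hit: "\<And>m. m \<in> carrier (int_lattice d) \<Longrightarrow> T m ` U\<^sub>1 \<inter> V\<^sub>1 \<noteq> {} \<Longrightarrow>
      \<forall>(U', V')\<in>P. T m ` U' \<inter> V' \<noteq> {}"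
    using insert.IH insert.prems by (metis insertCI)
  obtain n where n: "n \<in> carrier (int_lattice d)" "T n ` U\<^sub>1 \<inter> U\<^sub>2 \<noteq> {}" "T n ` V\<^sub>1 \<inter> V\<^sub>2 \<noteq> {}"
    using type_weakly_mixingE[OF mix] open\<^sub>1 open\<^sub>2 by metis
  define U where "U = U\<^sub>1 \<inter> {x \<in> topspace Y. T n x \<in> U\<^sub>2}"
  define V where "V = V\<^sub>1 \<inter> {x \<in> topspace Y. T n x \<in> V\<^sub>2}"
  note cont = int_action_continuous_map[OF act n(1)]
  have opens: "openin Y U" "openin Y V"
    unfolding U_def V_def using open\<^sub>1 open\<^sub>2 cont
    by (auto intro!: openin_Int openin_continuous_map_preimage)
  have nonempty: "U \<noteq> {}" "V \<noteq> {}"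
    using n(2,3) openin_subset[OF open\<^sub>1(1)] openin_subset[OF open\<^sub>1(3)]
    unfolding U_def V_def by blast+
  have "\<forall>(U', V')\<in>insert p P. T m ` U' \<inter> V' \<noteq> {}"
    if m: "m \<in> carrier (int_lattice d)" "T m ` U \<inter> V \<noteq> {}" for m
  proof -
    from m(2) obtain x where x: "x \<in> U" "T m x \<in> V"
      by blast
    then have "T m (T n x) = T n (T m x)"
      using int_action_commute[OF act m(1) n(1)] by (simp add: U_def)
    then have "T m ` U\<^sub>2 \<inter> V\<^sub>2 \<noteq> {}"
      using x unfolding U_def V_def by (metis (mono_tags, lifting) IntE disjoint_iff imageI mem_Collect_eq)
    moreover have "T m ` U\<^sub>1 \<inter> V\<^sub>1 \<noteq> {}"
      using x unfolding U_def V_def by blast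
    ultimately show ?thesis
      using hit[OF m(1)] p by simp
  qed
  then show ?case
    using opens nonempty by (intro exI[of _ U] exI[of _ V]) simp
qed

lemma weakly_mixing_common_hitting_time:
  assumes act: "int_action d Y T" and mix: "type_weakly_mixing d k Y T"
    and "finite P" "P \<noteq> {}"
    and "\<And>U V. (U, V) \<in> P \<Longrightarrow> openin Y U \<and> U \<noteq> {} \<and> openin Y V \<and> V \<noteq> {}"
  obtains m where "m \<in> carrier (int_lattice d)" "type_ge d k m \<one>\<^bsub>int_lattice d\<^esub>"
    and "\<And>U V. (U, V) \<in> P \<Longrightarrow> T m ` U \<inter> V \<noteq> {}"
proof -
  obtain U V where UV: "openin Y U" "U \<noteq> {}" "openin Y V" "V \<noteq> {}"
    and hit: "\<And>m. m \<in> carrier (int_lattice d) \<Longrightarrow> T m ` U \<inter> V \<noteq> {} \<Longrightarrow>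
      \<forall>(U', V')\<in>P. T m ` U' \<inter> V' \<noteq> {}"
    using weakly_mixing_hitting_times_refine[OF assms] by metis
  obtain m where "m \<in> carrier (int_lattice d)" "type_ge d k m \<one>\<^bsub>int_lattice d\<^esub>"
    and "T m ` U \<inter> V \<noteq> {}"
    using type_weakly_mixingE[OF mix UV UV] by metis
  with hit[of m] show thesis
    by (intro that[of m]) auto
qed


section \<open>Finite sets in the hyperspace\<close>

context Metric_space
begin

lemma hyperspaceD:
  assumes "A \<in> hyperspace"
  shows "closedin mtopology A" "A \<noteq> {}" "A \<subseteq> M"
  using assms closedin_subset by (fastforce simp: hyperspace_def)+

lemma finite_in_hyperspace:
  assumes "finite C" "C \<noteq> {}" "C \<subseteq> M"
  shows "C \<in> hyperspace"
  using assms
  by (simp add: hyperspace_def Hausdorff_space_mtopology compactin_imp_closedin finite_imp_compactin)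

lemma Hausdorff_metric_le:
  assumes "A \<in> hyperspace" "B \<in> hyperspace"
    and "\<And>a. a \<in> A \<Longrightarrow> \<exists>b\<in>B. d a b \<le> r" "\<And>b. b \<in> B \<Longrightarrow> \<exists>a\<in>A. d a b \<le> r"
  shows "Hausdorff_metric A B \<le> r"
proof -
  have "(SUP a\<in>A. point_dist a B) \<le> r"
    using assms(3) hyperspaceD(2)[OF assms(1)]
    by (intro cSUP_least) (meson order_trans point_dist_le)+
  moreover have "(SUP b\<in>B. point_dist b A) \<le> r"
    using assms(4) hyperspaceD(2)[OF assms(2)]
    by (intro cSUP_least) (metis commute order_trans point_dist_le)+
  ultimately show ?thesis
    using assms by (simp add: Hausdorff_metric_def)
qed

text \<open>Only the points of \<open>A\<close> that are not in the net cost the second \<open>r\<close>.\<close>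

lemma Hausdorff_metric_le_net:
  assumes "A \<in> hyperspace" "C \<in> hyperspace"
    and "F \<subseteq> A" "A \<subseteq> (\<Union>x\<in>F. mball x r)"
    and "\<And>a. a \<in> F \<Longrightarrow> \<exists>c\<in>C. c \<in> mball a r" "\<And>c. c \<in> C \<Longrightarrow> \<exists>a\<in>F. c \<in> mball a r"
  shows "Hausdorff_metric A C \<le> 2 * r"
proof (rule Hausdorff_metric_le[OF assms(1,2)])
  fix a assume a: "a \<in> A"
  then obtain x where x: "x \<in> F" "a \<in> mball x r"
    using assms(4) by blast
  obtain c where c: "c \<in> C" "c \<in> mball x r"
    using assms(5) x(1) by blast
  have "d a c \<le> d a x + d x c"
    using x c by (intro triangle) auto
  also have "\<dots> \<le> 2 * r"
    using x(2) c(2) commute[of a x] by auto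
  finally show "\<exists>c\<in>C. d a c \<le> 2 * r"
    using c(1) by blast
next
  fix c assume "c \<in> C"
  then obtain a where a: "a \<in> F" "c \<in> mball a r"
    using assms(6) by blast
  then have "d a c < r"
    by simp
  then have "d a c \<le> 2 * r"
    using nonneg[of a c] by linarith
  then show "\<exists>a\<in>A. d a c \<le> 2 * r"
    using a(1) assms(3) by blast
qed

lemma hyperspace_finite_net:
  assumes "compact_space mtopology" "A \<in> hyperspace" "r > 0"
  obtains F where "finite F" "F \<noteq> {}" "F \<subseteq> A" "A \<subseteq> (\<Union>x\<in>F. mball x r)"
proof -
  have "mtotally_bounded A"
    by (rule compactin_imp_mtotally_bounded[OF
        closedin_compact_space[OF assms(1) hyperspaceD(1)[OF assms(2)]]])
  with assms(3) have "\<exists>F. finite F \<and> F \<subseteq> A \<and> A \<subseteq> (\<Union>x\<in>F. mball x r)"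
    by (simp add: mtotally_bounded_def)
  then obtain F where "finite F" "F \<subseteq> A" "A \<subseteq> (\<Union>x\<in>F. mball x r)"
    by (elim exE conjE)
  moreover from this have "F \<noteq> {}"
    using hyperspaceD(2)[OF assms(2)] by auto
  ultimately show thesis
    by (intro that)
qed

lemma openin_hypertopologyE:
  assumes "compact_space mtopology" "openin hypertopology \<U>" "\<U> \<noteq> {}"
  obtains A e where "A \<in> hyperspace" "e > 0"
    and "\<And>C. C \<in> hyperspace \<Longrightarrow> Hausdorff_metric A C < e \<Longrightarrow> C \<in> \<U>"
proof -
  interpret H: Metric_space hyperspace Hausdorff_metric
    using assms(1) by (rule Metric_space_hyperspace)
  obtain A where "A \<in> \<U>"
    using assms(3) by blast
  then have "A \<in> hyperspace" "\<exists>e>0. H.mball A e \<subseteq> \<U>"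
    using assms(2) by (auto simp: H.openin_mtopology)
  then obtain e where "e > 0" "H.mball A e \<subseteq> \<U>"
    by blast
  with \<open>A \<in> hyperspace\<close> show thesis
    by (intro that[of A e]) (auto simp: subset_iff)
qed

end


section \<open>Transitivity of the induced action\<close>

theorem corollary3p3:
  fixes X :: "'a set" and \<rho> :: "'a \<Rightarrow> 'a \<Rightarrow> real"
    and d k :: nat and T :: "(nat \<Rightarrow> int) \<Rightarrow> 'a \<Rightarrow> 'a"
  assumes "Metric_space X \<rho>"
    and "compact_space (Metric_space.mtopology X \<rho>)"
    and "d \<ge> 1"
    and "int_action d (Metric_space.mtopology X \<rho>) T"
    and "k \<in> {1..2 ^ d}"
    and "type_weakly_mixing d k (Metric_space.mtopology X \<rho>) T"
  shows "type_transitive d k (Metric_space.hypertopology X \<rho>) (induced_action T)"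
proof -
  interpret Metric_space X \<rho>
    by fact
  note compact = assms(2) and act = assms(4) and mix = assms(6)
  have "\<exists>m\<in>carrier (int_lattice d). type_ge d k m \<one>\<^bsub>int_lattice d\<^esub> \<and> induced_action T m ` \<U> \<inter> \<V> \<noteq> {}"
    if \<U>: "openin hypertopology \<U>" "\<U> \<noteq> {}" and \<V>: "openin hypertopology \<V>" "\<V> \<noteq> {}" for \<U> \<V>
  proof -
    obtain A e\<^sub>A where A: "A \<in> hyperspace" "e\<^sub>A > 0"
      and A_ball: "\<And>C. C \<in> hyperspace \<Longrightarrow> Hausdorff_metric A C < e\<^sub>A \<Longrightarrow> C \<in> \<U>"
      using openin_hypertopologyE[OF compact \<U>] by metis
    obtain B e\<^sub>B where B: "B \<in> hyperspace" "e\<^sub>B > 0"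
      and B_ball: "\<And>C. C \<in> hyperspace \<Longrightarrow> Hausdorff_metric B C < e\<^sub>B \<Longrightarrow> C \<in> \<V>"
      using openin_hypertopologyE[OF compact \<V>] by metis
    \<comment> \<open>Replacing a set by points near its \<open>r\<close>-net moves it by at most \<open>2 * r\<close>.\<close>
    define r where "r = min e\<^sub>A e\<^sub>B / 3"
    have r: "r > 0" "2 * r < e\<^sub>A" "2 * r < e\<^sub>B"
      using A(2) B(2) by (auto simp: r_def)
    obtain F where F: "finite F" "F \<noteq> {}" "F \<subseteq> A" "A \<subseteq> (\<Union>x\<in>F. mball x r)"
      using hyperspace_finite_net[OF compact A(1) r(1)] .
    obtain G where G: "finite G" "G \<noteq> {}" "G \<subseteq> B" "B \<subseteq> (\<Union>x\<in>G. mball x r)"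
      using hyperspace_finite_net[OF compact B(1) r(1)] .
    have FG_X: "F \<subseteq> X" "G \<subseteq> X"
      using F(3) G(3) hyperspaceD(3) A(1) B(1) by blast+
    let ?P = "(\<lambda>(a, b). (mball a r, mball b r)) ` (F \<times> G)"
    obtain m where m: "m \<in> carrier (int_lattice d)" "type_ge d k m \<one>\<^bsub>int_lattice d\<^esub>"
      and hit: "\<And>U V. (U, V) \<in> ?P \<Longrightarrow> T m ` U \<inter> V \<noteq> {}"
    proof (rule weakly_mixing_common_hitting_time[OF act mix, of ?P])
      show "openin mtopology U \<and> U \<noteq> {} \<and> openin mtopology V \<and> V \<noteq> {}" if "(U, V) \<in> ?P" for U V
        using that FG_X r(1) by (auto simp: mball_eq_empty)
    qed (use F(1,2) G(1,2) in auto)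
    have "\<forall>p\<in>F \<times> G. \<exists>x. x \<in> mball (fst p) r \<and> T m x \<in> mball (snd p) r"
      using hit by fastforce
    then obtain c where "\<forall>p\<in>F \<times> G. c p \<in> mball (fst p) r \<and> T m (c p) \<in> mball (snd p) r"
      by (rule exE[OF bchoice])
    then have c: "c (a, b) \<in> mball a r \<and> T m (c (a, b)) \<in> mball b r" if "a \<in> F" "b \<in> G" for a b
      using that by fastforce
    define C where "C = c ` (F \<times> G)"
    have C: "C \<in> hyperspace"
      using F(1,2) G(1,2) c unfolding C_def by (intro finite_in_hyperspace) auto
    have TC: "T m ` C \<in> hyperspace"
      using F(1,2) G(1,2) c unfolding C_def by (intro finite_in_hyperspace) auto
    have "Hausdorff_metric A C \<le> 2 * r"
      using F(3,4)
    proof (rule Hausdorff_metric_le_net[OF A(1) C])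
      show "\<exists>x\<in>C. x \<in> mball a r" if "a \<in> F" for a
        using that G(2) c unfolding C_def by blast
      show "\<exists>a\<in>F. x \<in> mball a r" if "x \<in> C" for x
        using that c unfolding C_def by blast
    qed
    then have "C \<in> \<U>"
      using A_ball[OF C] r(2) by simp
    moreover have "Hausdorff_metric B (T m ` C) \<le> 2 * r"
      using G(3,4)
    proof (rule Hausdorff_metric_le_net[OF B(1) TC])
      show "\<exists>y\<in>T m ` C. y \<in> mball b r" if "b \<in> G" for b
        using that F(2) c unfolding C_def by blast
      show "\<exists>b\<in>G. y \<in> mball b r" if "y \<in> T m ` C" for y
        using that c unfolding C_def by blast
    qed
    then have "induced_action T m C \<in> \<V>"
      using B_ball[OF TC] r(3) by (simp add: induced_action_def)
    ultimately show ?thesis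
      using m by blast
  qed
  then show ?thesis
    unfolding type_transitive_def by blast
qed

end
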